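(* Let $A$ be a compactly generated locally compact abelian group and $M$ a compactly generated LC $A$-module. Then for every ascending sequence $M_0\subseteq M_1\subseteq\cdots$ of closed submodules of $M$, there exists $n_0$ such that for all $n\ge n_0$, $M_n$ is cocompact in $\overline{\bigcup_i M_i}$.
   Context: An LC $A$-module is an LCA group with a continuous action of $A$ by topological automorphisms. $M$ is compactly generated if there is a compact subset $K\subseteq M$ such that the $A$-submodule generated (algebraically) by $K$ is $M$. *)

theory Defs
  imports "HOL-Analysis.Analysis"
begin

definition add_subgroup :: "'m::ab_group_add set \<Rightarrow> bool" where
  "add_subgroup H \<longleftrightarrow> 0 \<in> H \<and> (\<forall>x\<in>H. \<forall>y\<in>H. x + y \<in> H) \<and> (\<forall>x\<in>H. - x \<in> H)"

definition gen_subgroup :: "'m::ab_group_add set \<Rightarrow> 'm set" where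
  "gen_subgroup K = \<Inter>{H. add_subgroup H \<and> K \<subseteq> H}"

text \<open>A locally compact abelian (Hausdorff) group: type class
  topological_ab_group_add + t2_space, plus local compactness.\<close>
definition compactly_generated_group :: "'a::topological_ab_group_add itself \<Rightarrow> bool" where
  "compactly_generated_group _ \<longleftrightarrow> (\<exists>K::'a set. compact K \<and> gen_subgroup K = UNIV)"

definition LC_module_action :: "('a::topological_ab_group_add \<Rightarrow> 'm::topological_ab_group_add \<Rightarrow> 'm) \<Rightarrow> bool" where
  "LC_module_action act \<longleftrightarrow>
     (\<forall>x. act 0 x = x) \<and>
     (\<forall>a b x. act (a + b) x = act a (act b x)) \<and>
     (\<forall>a x y. act a (x + y) = act a x + act a y) \<and>
     (\<forall>a. homeomorphism UNIV UNIV (act a) (act (- a))) \<and>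
     continuous_on UNIV (\<lambda>(a, x). act a x)"

definition submodule :: "('a \<Rightarrow> 'm::ab_group_add \<Rightarrow> 'm) \<Rightarrow> 'm set \<Rightarrow> bool" where
  "submodule act H \<longleftrightarrow> add_subgroup H \<and> (\<forall>a. act a ` H \<subseteq> H)"

definition gen_submodule :: "('a \<Rightarrow> 'm::ab_group_add \<Rightarrow> 'm) \<Rightarrow> 'm set \<Rightarrow> 'm set" where
  "gen_submodule act K = \<Inter>{H. submodule act H \<and> K \<subseteq> H}"

definition compactly_generated_module :: "('a \<Rightarrow> 'm::topological_ab_group_add \<Rightarrow> 'm) \<Rightarrow> bool" where
  "compactly_generated_module act \<longleftrightarrow> (\<exists>K. compact K \<and> gen_submodule act K = UNIV)"

definition coset_space :: "'m::ab_group_add set \<Rightarrow> 'm set \<Rightarrow> 'm set set" where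
  "coset_space N H = (\<lambda>x. (\<lambda>h. x + h) ` H) ` N"

definition quotient_top :: "'m::{ab_group_add,topological_space} set \<Rightarrow> 'm set \<Rightarrow> 'm set topology" where
  "quotient_top N H = topology (\<lambda>U. U \<subseteq> coset_space N H \<and> openin (top_of_set N) (\<Union>U))"

definition cocompact_in :: "'m::topological_ab_group_add set \<Rightarrow> 'm set \<Rightarrow> bool" where
  "cocompact_in H N \<longleftrightarrow> compact_space (quotient_top N H)"

end

theory Submission
  imports Defs "HOL-Computational_Algebra.Primes"
begin

text \<open>
  A compact symmetric neighbourhood \<open>S\<close> of \<open>0\<close> generating \<open>A\<close> satisfies \<open>S + S \<subseteq> F + S\<close> with \<open>F\<close> finite, so
  \<open>A = \<Gamma> + S\<close> with \<open>\<Gamma>\<close> finitely generated. Likewise \<open>M\<close> has a compact symmetric neighbourhood \<open>V\<close> of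
  \<open>0\<close> that generates it over \<open>\<Gamma>\<close>, and a finite \<open>F\<close> such that \<open>V + V\<close> and the translates of \<open>V\<close> by the
  generators of \<open>\<Gamma>\<close> lie in \<open>F + V\<close>. Let \<open>N\<close> be the closure of the union of the \<open>M\<^sub>n\<close>. By density every
  compact subset of \<open>N\<close> lies in \<open>W\<^sub>n = M\<^sub>n + (V \<inter> N)\<close> for large \<open>n\<close>; hence \<open>W\<^sub>n\<close> is eventually a
  \<open>\<Gamma>\<close>-submodule, and it remains to see that the \<open>W\<^sub>n\<close> stabilise, for then \<open>N = M\<^sub>n + (V \<inter> N)\<close>.

  This is a version of Hilbert's basis theorem modulo the error set \<open>V\<close>. An element of \<open>M\<close> is a
  polynomial combination of \<open>F\<close> plus an element of \<open>V\<close>; multiplying by a monomial of degree \<open>d\<close> turns the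
  error into terms of degree less than \<open>d\<close>. Choosing elements of \<open>W\<^sub>n\<^sub>+\<^sub>1 - W\<^sub>n\<close> with
  least leading term and applying Dickson's lemma shows that for almost all \<open>n\<close> with \<open>W\<^sub>n\<^sub>+\<^sub>1 \<noteq> W\<^sub>n\<close>
  the difference meets the subgroup generated by \<open>F \<union> V\<close>. There an element is a sum of \<open>k\<close> members of \<open>F\<close>
  plus an error; taking \<open>k\<close> least, Dickson's lemma reduces to \<open>k \<le> 1\<close>, and \<open>N \<inter> (V \<union> (F + V))\<close> is compact.
\<close>

section \<open>Generated subgroups\<close>

lemma add_subgroupD:
  assumes "add_subgroup H"
  shows "0 \<in> H" "x \<in> H \<Longrightarrow> y \<in> H \<Longrightarrow> x + y \<in> H" "x \<in> H \<Longrightarrow> - x \<in> H"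
    "x \<in> H \<Longrightarrow> y \<in> H \<Longrightarrow> x - y \<in> H"
  using assms unfolding add_subgroup_def
  by (auto simp: diff_conv_add_uminus simp del: add_uminus_conv_diff)

lemma add_subgroup_gen_subgroup: "add_subgroup (gen_subgroup X)"
  unfolding gen_subgroup_def add_subgroup_def by auto

lemma subset_gen_subgroup: "X \<subseteq> gen_subgroup X"
  unfolding gen_subgroup_def by auto

lemma gen_subgroup_minimal: "add_subgroup H \<Longrightarrow> X \<subseteq> H \<Longrightarrow> gen_subgroup X \<subseteq> H"
  unfolding gen_subgroup_def by auto

lemma gen_subgroup_mono: "X \<subseteq> Y \<Longrightarrow> gen_subgroup X \<subseteq> gen_subgroup Y"
  unfolding gen_subgroup_def by auto

lemma gen_subgroup_image_subset:
  fixes h :: "'a::ab_group_add \<Rightarrow> 'b::ab_group_add"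
  assumes h: "\<And>x y. h (x + y) = h x + h y" and H: "add_subgroup H" and sub: "h ` X \<subseteq> H"
  shows "h ` gen_subgroup X \<subseteq> H"
proof -
  have h0: "h 0 = 0" using h[of 0 0] by simp
  have hm: "h (- x) = - h x" for x using h[of x "- x"] h0 by (simp add: minus_unique)
  have "add_subgroup {x. h x \<in> H}"
    using add_subgroupD[OF H] by (simp add: add_subgroup_def h h0 hm)
  with gen_subgroup_minimal[of "{x. h x \<in> H}" X] sub show ?thesis by auto
qed

lemma sum_const_add: "(\<Sum>k<m + n. x) = (\<Sum>k<m. x) + (\<Sum>k<n. x::'a::comm_monoid_add)" for m n :: nat
  by (induction n) (simp_all add: add.assoc)

text \<open>Elements of the form multiple of \<open>e\<close> minus multiple of \<open>e\<close>
  plus \<open>y\<close> form a subgroup. Cancelling the common multiple and choosing the sign leaves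
  a natural number as coefficient, so that least coefficients exist later.\<close>

lemma gen_subgroup_insertE:
  assumes "x \<in> gen_subgroup (insert e X)"
  obtains c y where "y \<in> gen_subgroup X" "x = (\<Sum>k<c. e) + y \<or> - x = (\<Sum>k<(c::nat). e) + y"
proof -
  note G = add_subgroupD[OF add_subgroup_gen_subgroup[of X]]
  let ?H = "{(\<Sum>k<c. e) - (\<Sum>k<d. e) + y | (c::nat) (d::nat) y. y \<in> gen_subgroup X}"
  have "add_subgroup ?H"
    unfolding add_subgroup_def
  proof (intro conjI ballI)
    show "0 \<in> ?H"
      using G(1) by (intro CollectI exI[of _ "0::nat"] exI[of _ "0"]) auto
  next
    fix x y assume "x \<in> ?H" "y \<in> ?H"
    then obtain c d c' d' :: nat and u v where *: "u \<in> gen_subgroup X" "v \<in> gen_subgroup X"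
      "x = (\<Sum>k<c. e) - (\<Sum>k<d. e) + u" "y = (\<Sum>k<c'. e) - (\<Sum>k<d'. e) + v"
      by blast
    have "x + y = (\<Sum>k<c + c'. e) - (\<Sum>k<d + d'. e) + (u + v)"
      unfolding *(3,4) by (simp add: sum_const_add algebra_simps)
    with G(2)[OF *(1,2)] show "x + y \<in> ?H" by blast
  next
    fix x assume "x \<in> ?H"
    then obtain c d :: nat and u where *: "u \<in> gen_subgroup X" "x = (\<Sum>k<c. e) - (\<Sum>k<d. e) + u"
      by blast
    then have "- x = (\<Sum>k<d. e) - (\<Sum>k<c. e) + (- u)" by simp
    with G(3)[OF *(1)] show "- x \<in> ?H" by blast
  qed
  moreover have "insert e X \<subseteq> ?H"
  proof (intro insert_subsetI subsetI)
    show "e \<in> ?H" using G(1)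
      by (intro CollectI exI[of _ "1::nat"] exI[of _ "0"] exI[of _ "0"]) auto
    show "x \<in> ?H" if "x \<in> X" for x using that subset_gen_subgroup[of X]
      by (intro CollectI exI[of _ "0::nat"] exI[of _ x]) auto
  qed
  ultimately have "x \<in> ?H" using gen_subgroup_minimal assms by blast
  then obtain c d :: nat and y where *: "y \<in> gen_subgroup X" "x = (\<Sum>k<c. e) - (\<Sum>k<d. e) + y" by blast
  show ?thesis
  proof (cases "d \<le> c")
    case True
    then have "x = (\<Sum>k<c - d. e) + y"
      using * sum_const_add[of e "c - d" d] by simp
    with * that show ?thesis by blast
  next
    case False
    then have "- x = (\<Sum>k<d - c. e) + (- y)"
      using * sum_const_add[of e "d - c" c] by simp
    with G(3)[OF *(1)] that show ?thesis by blast
  qed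
qed

lemma add_subgroup_incseq_UN:
  assumes "\<And>i. add_subgroup (H i)" "incseq H"
  shows "add_subgroup (\<Union>i::nat. H i)"
  unfolding add_subgroup_def
proof (intro conjI ballI)
  show "0 \<in> (\<Union>i. H i)" using add_subgroupD(1)[OF assms(1)] by auto
  show "- x \<in> (\<Union>i. H i)" if "x \<in> (\<Union>i. H i)" for x using that add_subgroupD(3)[OF assms(1)] by auto
  fix x y assume "x \<in> (\<Union>i. H i)" "y \<in> (\<Union>i. H i)"
  then obtain m n where "x \<in> H m" "y \<in> H n" by auto
  then have "x \<in> H (max m n)" "y \<in> H (max m n)"
    using incseqD[OF assms(2), of m "max m n"] incseqD[OF assms(2), of n "max m n"] by auto
  then have "x + y \<in> H (max m n)" by (rule add_subgroupD(2)[OF assms(1)])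
  then show "x + y \<in> (\<Union>i. H i)" by blast
qed

text \<open>By \<open>VV\<close> the sum of two errors is again an error after splitting off one
  more element of \<open>F\<close>. Since \<open>F\<close> is symmetric, multisets suffice and no
  negative coefficients occur.\<close>

lemma add_subgroup_msum_plus:
  assumes symF: "\<And>x. x \<in> F \<Longrightarrow> - x \<in> F" and zeroV: "0 \<in> V" and symV: "\<And>v. v \<in> V \<Longrightarrow> - v \<in> V"
    and VV: "\<And>u v. u \<in> V \<Longrightarrow> v \<in> V \<Longrightarrow> \<exists>x\<in>F. u + v - x \<in> V"
  shows "add_subgroup {sum_mset c + v | c v. set_mset c \<subseteq> F \<and> v \<in> V}" (is "add_subgroup ?H")
  unfolding add_subgroup_def
proof (intro conjI ballI)
  show "0 \<in> ?H" using zeroV by (intro CollectI exI[of _ "{#}"] exI[of _ 0]) auto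
next
  fix x y assume "x \<in> ?H" "y \<in> ?H"
  then obtain c u d v where *: "set_mset c \<subseteq> F" "set_mset d \<subseteq> F" "u \<in> V" "v \<in> V"
    "x = sum_mset c + u" "y = sum_mset d + v" by blast
  obtain z where z: "z \<in> F" "u + v - z \<in> V" using VV * by blast
  have "x + y = sum_mset (add_mset z (c + d)) + (u + v - z)" using * by (simp add: algebra_simps)
  moreover have "set_mset (add_mset z (c + d)) \<subseteq> F" using * z by auto
  ultimately show "x + y \<in> ?H" using z by blast
next
  fix x assume "x \<in> ?H"
  then obtain c u where *: "set_mset c \<subseteq> F" "u \<in> V" "x = sum_mset c + u" by blast
  have "- sum_mset c = sum_mset (image_mset uminus c)" by (induction c) auto
  with * have "- x = sum_mset (image_mset uminus c) + (- u)" by simp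
  moreover have "set_mset (image_mset uminus c) \<subseteq> F" using * symF by auto
  ultimately show "- x \<in> ?H" using symV[OF *(2)] by blast
qed

section \<open>Dickson's lemma\<close>

lemma nat_seq_incseq_subseq:
  fixes x :: "nat \<Rightarrow> nat"
  obtains s where "strict_mono s" "incseq (\<lambda>n. x (s n))"
proof -
  obtain s where s: "strict_mono s" "monoseq (\<lambda>n. x (s n))" using seq_monosub by blast
  show ?thesis
  proof (cases "incseq (\<lambda>n. x (s n))")
    case False
    then have dec: "decseq (\<lambda>n. x (s n))" using s by (simp add: monoseq_iff)
    \<comment> \<open>\<open>N\<close> marks where the decreasing sequence attains its minimum; from
      there on it is constant.\<close>
    obtain N where N: "\<And>n. x (s N) \<le> x (s n)"
      using ex_has_least_nat[of "\<lambda>_. True" 0 "\<lambda>n. x (s n)"] by auto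
    have "x (s (n + N)) = x (s N)" for n
      using N[of "n + N"] decseqD[OF dec, of N "n + N"] by simp
    moreover have "strict_mono (\<lambda>n. s (n + N))"
      using s(1) by (simp add: strict_mono_def)
    ultimately show ?thesis using that[of "\<lambda>n. s (n + N)"] by (simp add: incseq_def)
  qed (use s that in blast)
qed

lemma dickson_subseq:
  fixes x :: "nat \<Rightarrow> 'k \<Rightarrow> nat"
  assumes "finite K"
  obtains s where "strict_mono s" "\<And>k. k \<in> K \<Longrightarrow> incseq (\<lambda>n. x (s n) k)"
  using assms
proof (induction K arbitrary: thesis rule: finite_induct)
  case empty
  then show ?case using strict_mono_id by blast
next
  case (insert k K)
  obtain s where s: "strict_mono s" "\<And>k. k \<in> K \<Longrightarrow> incseq (\<lambda>n. x (s n) k)" using insert by blast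
  obtain t where t: "strict_mono t" "incseq (\<lambda>n. x (s (t n)) k)"
    using nat_seq_incseq_subseq[of "\<lambda>n. x (s n) k"] by blast
  show ?case
  proof (rule insert.prems[of "s \<circ> t"])
    show "strict_mono (s \<circ> t)" using s t by (simp add: strict_mono_o)
    fix k' assume "k' \<in> insert k K"
    then show "incseq (\<lambda>n. x ((s \<circ> t) n) k')"
      using t s(2)[of k'] by (auto simp: incseq_def strict_mono_less_eq)
  qed
qed

lemma dickson_infinite_set:
  fixes x :: "nat \<Rightarrow> 'k \<Rightarrow> nat"
  assumes "finite K" "infinite J"
  obtains i j where "i \<in> J" "j \<in> J" "i < j" "\<And>k. k \<in> K \<Longrightarrow> x i k \<le> x j k"
proof -
  obtain r where r: "strict_mono (r::nat\<Rightarrow>nat)" "\<And>n. r n \<in> J"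
    using infinite_enumerate[OF assms(2)] by blast
  obtain s where s: "strict_mono s" "\<And>k. k \<in> K \<Longrightarrow> incseq (\<lambda>n. x (r (s n)) k)"
    using dickson_subseq[OF assms(1), of "\<lambda>n. x (r n)"] by blast
  show ?thesis
  proof (rule that[of "r (s 0)" "r (s 1)"])
    show "r (s 0) < r (s 1)" using r s by (simp add: strict_mono_less)
    show "x (r (s 0)) k \<le> x (r (s 1)) k" if "k \<in> K" for k
      using s(2)[OF that] by (simp add: incseq_def)
  qed (use r in auto)
qed

text \<open>For each jump take a multiset \<open>c j\<close> of least size. With infinitely many
  jumps, Dickson's lemma gives \<open>i < j\<close> with \<open>c i\<close> contained in
  \<open>c j\<close>. Subtracting the element for \<open>i\<close> from that for \<open>j\<close>
  cancels \<open>c i\<close> at the price of one new element of \<open>F\<close>, which contradicts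
  leastness.\<close>

lemma finite_jumps_meeting_msum_plus:
  fixes F V :: "'m::ab_group_add set" and N :: "nat \<Rightarrow> 'm set"
  assumes finF: "finite F" and symV: "\<And>v. v \<in> V \<Longrightarrow> - v \<in> V"
    and VV: "\<And>u v. u \<in> V \<Longrightarrow> v \<in> V \<Longrightarrow> \<exists>x\<in>F. u + v - x \<in> V"
    and sub: "\<And>j. add_subgroup (N j)" and mono: "incseq N"
    and small: "\<And>j x v. x \<in> insert 0 F \<Longrightarrow> v \<in> V \<Longrightarrow> x + v \<in> N j \<Longrightarrow> x + v \<in> N 0"
  shows "finite {j. \<exists>c v. set_mset c \<subseteq> F \<and> v \<in> V \<and> sum_mset c + v \<in> N (Suc j) - N j}" (is "finite ?J")
proof (rule ccontr)
  assume inf: "infinite ?J"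
  define Q where "Q j c \<longleftrightarrow> set_mset c \<subseteq> F \<and> (\<exists>v\<in>V. sum_mset c + v \<in> N (Suc j) - N j)" for j c
  define c where "c j = arg_min size (Q j)" for j
  have "\<exists>d. Q j d" if "j \<in> ?J" for j using that unfolding Q_def by blast
  then have c: "Q j (c j)" if "j \<in> ?J" for j
    using that arg_min_natI[of "Q j" _ size] unfolding c_def by blast
  have least: "size (c j) \<le> size d" if "Q j d" for j d
    using that arg_min_nat_le[of "Q j" d size] unfolding c_def by blast
  obtain i j where ij: "i \<in> ?J" "j \<in> ?J" "i < j" "\<And>k. k \<in> F \<Longrightarrow> count (c i) k \<le> count (c j) k"
    using dickson_infinite_set[OF finF inf, of "\<lambda>j. count (c j)"] by blast
  have Fi: "set_mset (c i) \<subseteq> F" and Fj: "set_mset (c j) \<subseteq> F"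
    using c[OF ij(1)] c[OF ij(2)] by (auto simp: Q_def)
  have le: "c i \<subseteq># c j"
  proof (rule mset_subset_eqI)
    show "count (c i) k \<le> count (c j) k" for k
      using ij(4)[of k] Fi not_in_iff[of k "c i"] by (cases "k \<in> F") auto
  qed
  obtain u where u: "u \<in> V" "sum_mset (c i) + u \<in> N (Suc i) - N i"
    using c[OF ij(1)] by (auto simp: Q_def)
  obtain v where v: "v \<in> V" "sum_mset (c j) + v \<in> N (Suc j) - N j"
    using c[OF ij(2)] by (auto simp: Q_def)
  \<comment> \<open>Smaller multisets give elements that \<open>small\<close> puts into
    \<open>N 0\<close>. Size two is what makes \<open>d\<close> below shorter than
    \<open>c j\<close>, as it drops \<open>c i\<close> but gains \<open>z\<close>.\<close>
  have "size (c i) \<ge> 2"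
  proof (rule ccontr)
    assume "\<not> size (c i) \<ge> 2"
    then have "size (c i) = 0 \<or> size (c i) = 1" by linarith
    then have "c i = {#} \<or> (\<exists>x. c i = {#x#})" using size_1_singleton_mset by auto
    then have "sum_mset (c i) \<in> insert 0 F" using Fi by auto
    then have "sum_mset (c i) + u \<in> N 0" using small u by blast
    with u(2) incseqD[OF mono, of 0 i] show False by blast
  qed
  obtain z where z: "z \<in> F" "v - u - z \<in> V" using VV[OF v(1) symV[OF u(1)]] by auto
  define d where "d = add_mset z (c j - c i)"
  have "sum_mset (c j) = sum_mset (c j - c i) + sum_mset (c i)"
    using le by (metis subset_mset.diff_add sum_mset.union)
  then have eq: "sum_mset d + (v - u - z) = (sum_mset (c j) + v) - (sum_mset (c i) + u)"
    by (simp add: d_def algebra_simps)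
  have iN: "sum_mset (c i) + u \<in> N j" using u incseqD[OF mono, of "Suc i" j] ij by auto
  have "sum_mset d + (v - u - z) \<in> N (Suc j)"
    unfolding eq using v(2) iN incseqD[OF mono, OF le_SucI[OF order_refl[of j]]]
    by (intro add_subgroupD(4)[OF sub]) auto
  moreover have "sum_mset d + (v - u - z) \<notin> N j"
  proof
    assume "sum_mset d + (v - u - z) \<in> N j"
    then have "sum_mset d + (v - u - z) + (sum_mset (c i) + u) \<in> N j"
      using iN by (rule add_subgroupD(2)[OF sub])
    with v(2) show False unfolding eq by simp
  qed
  moreover have "set_mset d \<subseteq> F" using z Fj by (auto simp: d_def dest: in_diffD)
  ultimately have "Q j d" using z unfolding Q_def by blast
  from least[OF this] have "size (c j) \<le> Suc (size (c j) - size (c i))"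
    using le by (simp add: d_def size_Diff_submset)
  moreover have "size (c i) \<le> size (c j)" using le by (rule size_mset_mono)
  ultimately show False using \<open>size (c i) \<ge> 2\<close> by linarith
qed

section \<open>Leading terms modulo an error set\<close>

text \<open>\<open>V\<close> is the error set and \<open>f\<close> lists the elements used as
  generators. The primes in \<open>P\<close> label the group elements \<open>g p\<close>, so that
  products of primes stand for compositions of the operators \<open>act (g p)\<close>. By
  \<open>gV\<close>, applying such an operator to an error costs one generator.\<close>

locale filtered_module =
  fixes act :: "'a::ab_group_add \<Rightarrow> 'm::ab_group_add \<Rightarrow> 'm"
    and P :: "nat set" and g :: "nat \<Rightarrow> 'a"
    and r :: nat and f :: "nat \<Rightarrow> 'm"
    and V :: "'m set"
  assumes act_zero: "act 0 x = x"
    and act_plus: "act (a + b) x = act a (act b x)"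
    and act_add: "act a (x + y) = act a x + act a y"
    and P: "finite P" "\<And>p. p \<in> P \<Longrightarrow> prime p"
    and r: "r > 0"
    and gV: "p \<in> P \<Longrightarrow> v \<in> V \<Longrightarrow> \<exists>l<r. act (g p) v - f l \<in> V"
begin

definition smooth :: "nat set" where
  "smooth = {a. a > 0 \<and> prime_factors a \<subseteq> P}"

definition \<tau> :: "nat \<Rightarrow> 'a" where
  "\<tau> a = (\<Sum>p\<in>#prime_factorization a. g p)"

text \<open>Smooth numbers encode the monomials in the operators \<open>act (g p)\<close>, so that the usual order of
  the natural numbers is a monomial order. The number \<open>a * r + i\<close> with \<open>i < r\<close> encodes the monomial
  \<open>a\<close> applied to the generator \<open>f i\<close>.\<close>

definition e :: "nat \<Rightarrow> 'm" where
  "e n = (if n div r \<in> smooth then act (\<tau> (n div r)) (f (n mod r)) else 0)"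

text \<open>This is the filtration by leading terms: passing from \<open>T n\<close> to
  \<open>T (Suc n)\<close> adjoins \<open>e n\<close>. Generators and errors belong to every level,
  so lower terms are only controlled modulo \<open>T 0\<close>.\<close>

definition T :: "nat \<Rightarrow> 'm set" where
  "T n = gen_subgroup (f ` {..<r} \<union> V \<union> e ` {..<n})"

lemma act_zero_right: "act a 0 = 0"
  using act_add[of a 0 0] by simp

lemma act_minus: "act a (- x) = - act a x"
  using act_add[of a x "- x"] by (simp add: act_zero_right minus_unique)

lemma act_sum_const: "act a (\<Sum>k<n. x) = (\<Sum>k<n. act a x)" for n :: nat
  by (induction n) (simp_all add: act_zero_right act_add)

lemma one_smooth: "1 \<in> smooth"
  by (simp add: smooth_def)

lemma tau_one: "\<tau> 1 = 0"
  by (simp add: \<tau>_def)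

lemma smooth_pos: "a \<in> smooth \<Longrightarrow> a > 0"
  by (simp add: smooth_def)

lemma smooth_mult_iff: "a > 0 \<Longrightarrow> b > 0 \<Longrightarrow> a * b \<in> smooth \<longleftrightarrow> a \<in> smooth \<and> b \<in> smooth"
  by (auto simp: smooth_def prime_factors_product)

lemma tau_mult: "a > 0 \<Longrightarrow> b > 0 \<Longrightarrow> \<tau> (a * b) = \<tau> a + \<tau> b"
  by (simp add: \<tau>_def prime_factorization_mult)

lemma prime_smooth: "p \<in> P \<Longrightarrow> p \<in> smooth" and tau_prime: "p \<in> P \<Longrightarrow> \<tau> p = g p"
  using P(2)[of p] by (auto simp: smooth_def \<tau>_def prime_factorization_prime prime_gt_0_nat)

lemma msum_eq_tau:
  assumes "set_mset c \<subseteq> g ` P"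
  shows "\<exists>b\<in>smooth. sum_mset c = \<tau> b"
  using assms
proof (induction c)
  case empty
  then show ?case using one_smooth tau_one by force
next
  case (add x c)
  then obtain b p where "b \<in> smooth" "sum_mset c = \<tau> b" "p \<in> P" "x = g p" by auto
  then have "sum_mset (add_mset x c) = \<tau> (p * b)" "p * b \<in> smooth"
    using prime_smooth[of p] tau_prime[of p] smooth_pos[of b] smooth_pos[of p]
    by (auto simp: tau_mult smooth_mult_iff)
  then show ?case by blast
qed

text \<open>The prime is split off on the right so that, in the inductions below, the operator
  \<open>act (g p)\<close> is applied first.\<close>

lemma smooth_induct [consumes 1, case_names one mult]:
  assumes "b \<in> smooth" "Q 1" "\<And>b p. b \<in> smooth \<Longrightarrow> p \<in> P \<Longrightarrow> Q b \<Longrightarrow> Q (b * p)"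
  shows "Q b"
  using assms(1)
proof (induction b rule: less_induct)
  case (less b)
  show ?case
  proof (cases "b = 1")
    case False
    then obtain p where p: "prime p" "p dvd b" using prime_factor_nat by blast
    from p(2) obtain b' where "b = p * b'" by (rule dvdE)
    then have b': "b = b' * p" by (simp add: mult.commute)
    have "p \<in> prime_factors b" using p less.prems by (simp add: smooth_def in_prime_factors_iff)
    then have "p \<in> P" using less.prems by (auto simp: smooth_def)
    moreover have "b' > 0" "p > 1" "b' \<in> smooth"
      using less.prems b' p smooth_pos[of b] smooth_mult_iff[of b' p] prime_gt_1_nat[of p] by auto
    ultimately show ?thesis using less.IH[of b'] assms(3) b' by simp
  qed (use assms(2) in simp)
qed

lemma act_tau_mult_prime: "b \<in> smooth \<Longrightarrow> p \<in> P \<Longrightarrow> act (\<tau> (b * p)) x = act (\<tau> b) (act (g p) x)"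
  using smooth_pos[of b] smooth_pos[OF prime_smooth[of p]] by (simp add: tau_mult act_plus tau_prime)

lemma T_subgroup: "add_subgroup (T n)"
  unfolding T_def by (rule add_subgroup_gen_subgroup)

lemma T_mono: "m \<le> n \<Longrightarrow> T m \<subseteq> T n"
  unfolding T_def by (rule gen_subgroup_mono) auto

lemma V_in_T: "v \<in> V \<Longrightarrow> v \<in> T n" and f_in_T: "l < r \<Longrightarrow> f l \<in> T n" and e_in_T: "m < n \<Longrightarrow> e m \<in> T n"
  using subset_gen_subgroup[of "f ` {..<r} \<union> V \<union> e ` {..<n}"] by (auto simp: T_def)

lemma e_pair: "l < r \<Longrightarrow> a \<in> smooth \<Longrightarrow> e (a * r + l) = act (\<tau> a) (f l)"
  by (simp add: e_def)

text \<open>The first operator turns the error \<open>v\<close> into some \<open>f l\<close> plus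
  another error. The remaining monomial \<open>b\<close> is smaller than \<open>b * p\<close>: it
  sends \<open>f l\<close> to \<open>e (b * r + l)\<close>, and the induction hypothesis handles the
  new error.\<close>

lemma act_tau_V:
  assumes "b \<in> smooth" "v \<in> V"
  shows "act (\<tau> b) v \<in> T (b * r)"
  using assms
proof (induction b arbitrary: v rule: smooth_induct)
  case one
  then show ?case using V_in_T by (simp add: tau_one[simplified] act_zero)
next
  case (mult b p)
  obtain l where l: "l < r" "act (g p) v - f l \<in> V" using gV mult by blast
  have "act (\<tau> (b * p)) v = act (\<tau> b) (f l + (act (g p) v - f l))"
    using mult by (simp add: act_tau_mult_prime)
  then have eq: "act (\<tau> (b * p)) v = e (b * r + l) + act (\<tau> b) (act (g p) v - f l)"
    using l mult by (simp only: act_add e_pair)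
  \<comment> \<open>A whole block of \<open>r\<close> codes fits between \<open>b * r\<close> and
    \<open>b * p * r\<close>, which leaves room for the residue \<open>l\<close>.\<close>
  have "b < b * p" using smooth_pos[OF mult(1)] prime_gt_1_nat[OF P(2)[OF mult(2)]] by simp
  then have "Suc b \<le> b * p" by (rule Suc_leI)
  then have le: "Suc b * r \<le> b * p * r" by (intro mult_right_mono) auto
  then have "e (b * r + l) \<in> T (b * p * r)" using l by (intro e_in_T) auto
  moreover have "act (\<tau> b) (act (g p) v - f l) \<in> T (b * p * r)"
  proof -
    have "b * r \<le> b * p * r" using \<open>b < b * p\<close> by (intro mult_right_mono) auto
    then show ?thesis using mult.IH[OF l(2)] T_mono by blast
  qed
  ultimately show ?case unfolding eq by (rule add_subgroupD(2)[OF T_subgroup])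
qed

text \<open>Multiplication by a monomial preserves the order of leading terms, and the generators
  and errors present in every level are sent to codes below \<open>a * b * r\<close>, because
  \<open>a \<ge> 2\<close>.\<close>

lemma act_tau_T:
  assumes b: "b \<in> smooth" and a: "a \<ge> 2" and i: "i < r"
  shows "act (\<tau> b) ` T (a * r + i) \<subseteq> T (a * b * r + i)"
  unfolding T_def[of "a * r + i"]
proof (rule gen_subgroup_image_subset[OF act_add T_subgroup], safe)
  have "Suc b \<le> a * b" using a smooth_pos[OF b] mult_right_mono[of 2 a b] by linarith
  then have le: "Suc b * r \<le> a * b * r" by (intro mult_right_mono) auto
  show "act (\<tau> b) (f l) \<in> T (a * b * r + i)" if "l < r" for l
    using e_in_T[of "b * r + l" "a * b * r + i"] e_pair[OF that b] le that by simp
  show "act (\<tau> b) v \<in> T (a * b * r + i)" if "v \<in> V" for v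
    using act_tau_V[OF b that] T_mono[of "b * r" "a * b * r + i"] le by auto
  show "act (\<tau> b) (e m) \<in> T (a * b * r + i)" if m: "m < a * r + i" for m
  proof (cases "m div r \<in> smooth")
    case True
    define a' l where "a' = m div r" and "l = m mod r"
    have l: "l < r" and m_eq: "m = a' * r + l" and a': "a' \<in> smooth"
      using r True by (simp_all add: a'_def l_def)
    have "act (\<tau> b) (e m) = e (a' * b * r + l)"
      using smooth_pos[OF b] smooth_pos[OF a'] l a' b
      by (simp add: m_eq e_pair smooth_mult_iff tau_mult add.commute[of "\<tau> a'"] act_plus)
    moreover have "a' * b * r + l < a * b * r + i"
    \<comment> \<open>Codes compare lexicographically: a smaller monomial outweighs any residue, and
      for equal monomials the residues decide.\<close>
    proof (cases "a' < a")
      case True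
      then have "Suc a' * b * r \<le> a * b * r" by (intro mult_right_mono) auto
      moreover have "r \<le> b * r" using smooth_pos[OF b] by simp
      moreover have "Suc a' * b * r = b * r + a' * b * r" by (simp add: algebra_simps)
      ultimately show ?thesis using l by linarith
    next
      case False
      have "a' = a"
      proof (rule ccontr)
        assume "a' \<noteq> a"
        then have "Suc a * r \<le> a' * r" using False by (intro mult_right_mono) auto
        then show False using m i by (simp add: m_eq)
      qed
      then show ?thesis using m by (simp add: m_eq)
    qed
    ultimately show ?thesis using e_in_T by simp
  next
    case False
    then show ?thesis using add_subgroupD(1)[OF T_subgroup] by (simp add: e_def act_zero_right)
  qed
qed

text \<open>The elements whose whole orbit lies in the union form a submodule. It contains
  \<open>K\<close>: splitting \<open>a\<close> into a sum of operators and some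
  \<open>s \<in> S\<close>, the part \<open>s\<close> moves \<open>K\<close> into \<open>V\<close>,
  and \<open>act_tau_V\<close> applies.\<close>

lemma spanning_T:
  assumes decomp: "\<And>a. \<exists>c s. set_mset c \<subseteq> g ` P \<and> s \<in> S \<and> a = sum_mset c + s"
    and SK: "\<And>s x. s \<in> S \<Longrightarrow> x \<in> K \<Longrightarrow> act s x \<in> V"
    and gen: "gen_submodule act K = UNIV"
  shows "(\<Union>n. T n) = UNIV"
proof -
  let ?H = "\<Union>n. T n"
  have H: "add_subgroup ?H"
    by (intro add_subgroup_incseq_UN T_subgroup) (simp add: incseq_def T_mono)
  have "submodule act {x. \<forall>a. act a x \<in> ?H}"
    unfolding submodule_def add_subgroup_def
    using add_subgroupD(1-3)[OF H] by (auto simp: act_add act_minus act_zero_right simp flip: act_plus)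
  moreover have "K \<subseteq> {x. \<forall>a. act a x \<in> ?H}"
  proof (intro subsetI CollectI allI)
    fix x a assume x: "x \<in> K"
    obtain c s where cs: "set_mset c \<subseteq> g ` P" "s \<in> S" "a = sum_mset c + s" using decomp by blast
    obtain b where b: "b \<in> smooth" "sum_mset c = \<tau> b" using msum_eq_tau[OF cs(1)] by blast
    have "act a x = act (\<tau> b) (act s x)" by (simp add: cs b act_plus)
    then show "act a x \<in> ?H" using act_tau_V[OF b(1) SK[OF cs(2) x]] by auto
  qed
  ultimately have "gen_submodule act K \<subseteq> {x. \<forall>a. act a x \<in> ?H}"
    unfolding gen_submodule_def by (intro Inter_lower) simp
  then have "act 0 x \<in> ?H" for x using gen by blast
  then show ?thesis by (auto simp: act_zero)
qed

text \<open>As in Hilbert's basis theorem, each jump gets a witness with least leading term and then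
  least coefficient. Dickson's lemma finds two jumps \<open>i < j\<close> where the leading term for
  \<open>i\<close> divides that for \<open>j\<close> and has no larger coefficient; a monomial
  multiple of the earlier witness is subtracted from the later one.\<close>

lemma finite_jumps_missing_T0:
  assumes sub: "\<And>j. add_subgroup (N j)" and mono: "incseq N"
    and inv: "\<And>j p. p \<in> P \<Longrightarrow> act (g p) ` N j \<subseteq> N j"
    and spanning: "(\<Union>n. T n) = UNIV"
  shows "finite {j. N (Suc j) \<noteq> N j \<and> (N (Suc j) - N j) \<inter> T 0 = {}}" (is "finite ?J")
proof (rule ccontr)
  assume inf: "infinite ?J"
  have inv_tau: "act (\<tau> b) x \<in> N j" if "b \<in> smooth" "x \<in> N j" for b x j
    using that
  proof (induction b arbitrary: x rule: smooth_induct)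
    case one
    then show ?case by (simp add: tau_one[simplified] act_zero)
  next
    case (mult b p)
    then show ?case using inv[of p j] by (auto simp: act_tau_mult_prime)
  qed
  define D where "D j = N (Suc j) - N j" for j
  have D_ne: "D j \<noteq> {}" and D_T0: "D j \<inter> T 0 = {}" if "j \<in> ?J" for j
    using that incseqD[OF mono, of j "Suc j"] unfolding D_def by auto
  have D_neg: "- d \<in> D j" if "d \<in> D j" for d j
    using that add_subgroupD(3)[OF sub, of d "Suc j"] add_subgroupD(3)[OF sub, of "- d" j] by (auto simp: D_def)
  \<comment> \<open>Code of the least leading term in the jump. Disjointness from \<open>T 0\<close>
    is what settles \<open>m_min\<close> when this code is 0.\<close>
  define m where "m j = (LEAST m. D j \<inter> T (Suc m) \<noteq> {})" for j
  have m: "D j \<inter> T (Suc (m j)) \<noteq> {}" and m_min: "D j \<inter> T (m j) = {}" if j: "j \<in> ?J" for j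
  proof -
    obtain d n where "d \<in> D j" "d \<in> T n" using D_ne[OF j] spanning by blast
    then have "D j \<inter> T (Suc n) \<noteq> {}" using T_mono[of n "Suc n"] by auto
    then show "D j \<inter> T (Suc (m j)) \<noteq> {}" unfolding m_def by (rule LeastI)
    show "D j \<inter> T (m j) = {}"
    proof (cases "m j")
      case 0
      then show ?thesis using D_T0[OF j] by simp
    next
      case (Suc k)
      then show ?thesis using not_less_Least[of k "\<lambda>m. D j \<inter> T (Suc m) \<noteq> {}"] by (simp add: m_def)
    qed
  qed
  \<comment> \<open>\<open>c\<close> is the coefficient of the leading term. It may be taken as a
    natural number because \<open>D j\<close> is closed under negation.\<close>
  define Q where "Q j c \<longleftrightarrow> (\<exists>y\<in>T (m j). (\<Sum>k<(c::nat). e (m j)) + y \<in> D j)" for j c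
  have "\<exists>c. Q j c" if j: "j \<in> ?J" for j
  proof -
    obtain d where d: "d \<in> D j" "d \<in> T (Suc (m j))" using m[OF j] by blast
    then have "d \<in> gen_subgroup (insert (e (m j)) (f ` {..<r} \<union> V \<union> e ` {..<m j}))"
      by (simp add: T_def lessThan_Suc)
    then obtain c y where "y \<in> T (m j)" "d = (\<Sum>k<c. e (m j)) + y \<or> - d = (\<Sum>k<(c::nat). e (m j)) + y"
      by (rule gen_subgroup_insertE) (auto simp: T_def)
    then show ?thesis unfolding Q_def using d(1) D_neg[OF d(1)] by metis
  qed
  define c where "c j = (LEAST c. Q j c)" for j
  have c: "Q j (c j)" if "j \<in> ?J" for j
    unfolding c_def using \<open>\<And>j. j \<in> ?J \<Longrightarrow> \<exists>c. Q j c\<close>[OF that] by (rule LeastI_ex)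
  define a where "a j = m j div r" for j
  \<comment> \<open>Otherwise the leading term could be absorbed, and \<open>D j\<close> would meet
    \<open>T (m j)\<close>.\<close>
  have e_notin: "e (m j) \<notin> T (m j)" if j: "j \<in> ?J" for j
  proof
    assume e: "e (m j) \<in> T (m j)"
    have "(\<Sum>k<n. e (m j)) \<in> T (m j)" for n :: nat
      by (induction n) (use add_subgroupD[OF T_subgroup] e in auto)
    with c[OF j] m_min[OF j] show False unfolding Q_def
      using add_subgroupD(2)[OF T_subgroup, of _ "m j"] by blast
  qed
  \<comment> \<open>If \<open>a j\<close> were not smooth, \<open>e (m j)\<close> would be 0; if it
    were 1, \<open>e (m j)\<close> would be a generator. Both lie in \<open>T (m j)\<close>. The
    bound 2 is the one that \<open>act_tau_T\<close> asks for.\<close>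
  have smooth: "a j \<in> smooth" and a2: "a j \<ge> 2" if j: "j \<in> ?J" for j
  proof -
    show s: "a j \<in> smooth"
      using e_notin[OF j] add_subgroupD(1)[OF T_subgroup] by (auto simp: e_def a_def split: if_splits)
    have "a j \<noteq> 1"
    proof
      assume "a j = 1"
      then have "e (m j) = f (m j mod r)"
        using s by (simp add: e_def a_def tau_one[simplified] act_zero)
      with e_notin[OF j] f_in_T[of "m j mod r" "m j"] r show False by simp
    qed
    with smooth_pos[OF s] show "a j \<ge> 2" by linarith
  qed
  \<comment> \<open>The keys 0, 1 and 4 are not prime; 1 and 4 together force equality of \<open>m j mod r\<close>.\<close>
  define z where "z j k = (if k \<in> P then multiplicity k (a j) else if k = 0 then c j
      else if k = 1 then m j mod r else r - m j mod r)" for j k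
  have notP: "0 \<notin> P" "1 \<notin> P" "4 \<notin> P" using P(2)[of 0] P(2)[of 1] P(2)[of 4] by auto
  obtain i j where ij: "i \<in> ?J" "j \<in> ?J" "i < j" and zle: "\<And>k. k \<in> P \<union> {0, 1, 4} \<Longrightarrow> z i k \<le> z j k"
    using dickson_infinite_set[OF _ inf, of "P \<union> {0, 1, 4}" z] P(1) by auto
  have c_le: "c i \<le> c j" using zle[of 0] notP by (simp add: z_def)
  have l_eq: "m i mod r = m j mod r"
    using zle[of 1] zle[of 4] notP r mod_less_divisor[OF r, of "m i"] mod_less_divisor[OF r, of "m j"]
    by (simp add: z_def)
  define l where "l = m j mod r"
  have "a i dvd a j"
  proof (rule multiplicity_le_imp_dvd)
    show "a i \<noteq> 0" using a2[OF ij(1)] by simp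
    fix p :: nat assume p: "prime p"
    show "multiplicity p (a i) \<le> multiplicity p (a j)"
    proof (cases "p \<in> P")
      case True
      then show ?thesis using zle[of p] by (simp add: z_def)
    next
      case False
      then have "p \<notin> prime_factors (a i)" using smooth[OF ij(1)] by (auto simp: smooth_def)
      then have "multiplicity p (a i) = 0" using p by (simp add: prime_factors_multiplicity)
      then show ?thesis by simp
    qed
  qed
  then obtain b where b: "a j = a i * b" by (rule dvdE)
  have b_smooth: "b \<in> smooth"
    using smooth[OF ij(2)] smooth_mult_iff[of "a i" b] a2[OF ij(1)] a2[OF ij(2)]
    by (cases "b = 0") (auto simp: b)
  have mi: "m i = a i * r + l"
    unfolding a_def l_def l_eq[symmetric] by simp
  have mj: "m j = a i * b * r + l"
    unfolding b[symmetric] unfolding a_def l_def by simp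
  have l: "l < r" using r by (simp add: l_def)
  obtain x where x: "x \<in> T (m i)" "(\<Sum>k<c i. e (m i)) + x \<in> D i" using c[OF ij(1)] Q_def by blast
  obtain y where y: "y \<in> T (m j)" "(\<Sum>k<c j. e (m j)) + y \<in> D j" using c[OF ij(2)] Q_def by blast
  \<comment> \<open>The monomial \<open>b\<close> moves the leading term of the witness for
    \<open>i\<close> onto that for \<open>j\<close>. As \<open>Suc i \<le> j\<close>, the result
    lies in \<open>N j\<close>, so subtracting it from an element of \<open>D j\<close> stays in
    \<open>D j\<close>.\<close>
  define d where "d = act (\<tau> b) ((\<Sum>k<c i. e (m i)) + x)"
  have "act (\<tau> b) (e (m i)) = e (m j)"
    unfolding mi mj using l smooth[OF ij(1)] b_smooth smooth_pos[of b] smooth_pos[of "a i"]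
    by (simp add: e_pair smooth_mult_iff tau_mult add.commute[of "\<tau> (a i)"] act_plus)
  then have d: "d = (\<Sum>k<c i. e (m j)) + act (\<tau> b) x"
    by (simp add: d_def act_add act_sum_const)
  have "d \<in> N j"
    using x(2) inv_tau[OF b_smooth, of _ "Suc i"] incseqD[OF mono, of "Suc i" j] ij(3) by (auto simp: d_def D_def)
  have "(\<Sum>k<c j. e (m j)) = (\<Sum>k<c j - c i. e (m j)) + (\<Sum>k<c i. e (m j))"
    using sum_const_add[of "e (m j)" "c j - c i" "c i"] c_le by simp
  then have eq: "(\<Sum>k<c j - c i. e (m j)) + (y - act (\<tau> b) x) = (\<Sum>k<c j. e (m j)) + y - d"
    by (simp add: d)
  have "y - act (\<tau> b) x \<in> T (m j)"
    using act_tau_T[OF b_smooth a2[OF ij(1)] l] x(1) y(1) add_subgroupD(4)[OF T_subgroup]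
    unfolding mi mj by blast
  moreover have "(\<Sum>k<c j. e (m j)) + y - d \<in> N (Suc j)"
    using y(2) \<open>d \<in> N j\<close> incseqD[OF mono, OF le_SucI[OF order_refl[of j]]]
    by (intro add_subgroupD(4)[OF sub]) (auto simp: D_def)
  moreover have "(\<Sum>k<c j. e (m j)) + y - d \<notin> N j"
  proof
    assume "(\<Sum>k<c j. e (m j)) + y - d \<in> N j"
    then have "(\<Sum>k<c j. e (m j)) + y - d + d \<in> N j"
      using \<open>d \<in> N j\<close> by (rule add_subgroupD(2)[OF sub])
    with y(2) show False by (simp add: D_def)
  qed
  ultimately have "Q j (c j - c i)" unfolding Q_def D_def eq[symmetric] by blast
  \<comment> \<open>Leastness of \<open>c j\<close> forces \<open>c i = 0\<close>. The witness for
    \<open>i\<close> then reduces to \<open>x\<close>, which lies in \<open>T (m i)\<close> against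
    \<open>m_min\<close>.\<close>
  then have "c j \<le> c j - c i" unfolding c_def[of j] by (rule Least_le)
  then have "c i = 0" using c_le by linarith
  then have "x \<in> D i" using x(2) by simp
  with x(1) m_min[OF ij(1)] show False by blast
qed

end

section \<open>Compact sets in topological abelian groups\<close>

text \<open>Every neighbourhood \<open>x - U\<close> of a point \<open>x\<close> of \<open>C\<close>
  meets \<open>D\<close>, so the translates of \<open>U\<close> by elements of \<open>D\<close>
  cover \<open>C\<close>. Allowing a dense \<open>D\<close> lets the centres be chosen in the union
  of the chain.\<close>

lemma compact_subset_finite_translates:
  fixes C :: "'a::topological_ab_group_add set"
  assumes "compact C" "open U" "0 \<in> U" and D: "C \<subseteq> closure D"
  obtains F where "finite F" "F \<subseteq> D" "\<And>x. x \<in> C \<Longrightarrow> \<exists>y\<in>F. x - y \<in> U"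
proof -
  define W where "W y = (\<lambda>x. x - y) -` U" for y
  have "open (W y)" for y
    unfolding W_def by (intro open_vimage assms continuous_intros)
  moreover have "C \<subseteq> (\<Union>y\<in>D. W y)"
  proof
    fix x assume "x \<in> C"
    have "open ((\<lambda>y. x - y) -` U)" by (intro open_vimage assms continuous_intros)
    moreover have "x \<in> ((\<lambda>y. x - y) -` U) \<inter> closure D" using assms \<open>x \<in> C\<close> by auto
    ultimately have "((\<lambda>y. x - y) -` U) \<inter> D \<noteq> {}"
      using open_Int_closure_eq_empty by blast
    then show "x \<in> (\<Union>y\<in>D. W y)" by (auto simp: W_def)
  qed
  ultimately obtain F where "F \<subseteq> D" "finite F" "C \<subseteq> (\<Union>y\<in>F. W y)"
    using compactE_image[OF assms(1), of D W] by blast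
  then show ?thesis by (intro that[of F]) (auto simp: W_def)
qed

lemma compact_sum_image:
  fixes A B :: "'a::topological_ab_group_add set"
  assumes "compact A" "compact B"
  shows "compact ((\<lambda>(x, y). x + y) ` (A \<times> B))"
  by (intro compact_continuous_image compact_Times assms)
     (auto simp: case_prod_unfold intro!: continuous_intros)

lemma compact_uminus_image:
  fixes A :: "'a::topological_ab_group_add set"
  assumes "compact A"
  shows "compact (uminus ` A)"
  by (intro compact_continuous_image assms continuous_intros)

lemma symmetric_compact_neighbourhood:
  fixes C :: "'a::topological_ab_group_add set"
  assumes "locally_compact_space (euclidean :: 'a topology)" "compact C"
  obtains U V where "open U" "0 \<in> U" "U \<subseteq> V" "compact V" "C \<subseteq> V" "\<And>v. v \<in> V \<Longrightarrow> - v \<in> V"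
proof -
  obtain U K where UK: "open U" "0 \<in> U" "U \<subseteq> K" "compact (K :: 'a set)"
    using assms(1) unfolding locally_compact_space_def by simp blast
  define V where "V = (K \<union> C) \<union> uminus ` (K \<union> C)"
  show ?thesis
  proof (rule that)
    show "open U" "0 \<in> U" by fact+
    show "U \<subseteq> V" "C \<subseteq> V" using UK(3) by (auto simp: V_def)
    show "compact V" unfolding V_def by (intro compact_Un compact_uminus_image UK assms)
    show "- v \<in> V" if "v \<in> V" for v using that by (auto simp: V_def)
  qed
qed

text \<open>Finitely many translates of a symmetric compact neighbourhood \<open>S\<close> cover
  \<open>S + S\<close>. By \<open>add_subgroup_msum_plus\<close> the sums of translation elements
  plus one element of \<open>S\<close> then form a subgroup, and it contains the generating
  set.\<close>

lemma compactly_generated_group_decomposition: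
  assumes "locally_compact_space (euclidean :: 'a::topological_ab_group_add topology)"
    and "compactly_generated_group TYPE('a::topological_ab_group_add)"
  obtains X S :: "'a::topological_ab_group_add set" where "finite X" "compact S"
    "\<And>a. \<exists>c s. set_mset c \<subseteq> X \<and> s \<in> S \<and> a = sum_mset c + s"
proof -
  obtain C :: "'a set" where C: "compact C" "gen_subgroup C = UNIV"
    using assms(2) unfolding compactly_generated_group_def by blast
  obtain U S where S: "open U" "0 \<in> U" "U \<subseteq> S" "compact S" "C \<subseteq> S" "\<And>v. v \<in> S \<Longrightarrow> - v \<in> S"
    using symmetric_compact_neighbourhood[OF assms(1) C(1)] by blast
  obtain F where F: "finite F" "\<And>x. x \<in> (\<lambda>(x, y). x + y) ` (S \<times> S) \<Longrightarrow> \<exists>y\<in>F. x - y \<in> U"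
    using compact_subset_finite_translates[OF compact_sum_image[OF S(4,4)] S(1,2), of UNIV] by auto
  define X where "X = F \<union> uminus ` F"
  have VV: "\<exists>x\<in>X. u + v - x \<in> S" if "u \<in> S" "v \<in> S" for u v
    using F(2)[of "u + v"] that S(3) unfolding X_def by blast
  have "add_subgroup {sum_mset c + v | c v. set_mset c \<subseteq> X \<and> v \<in> S}"
    using S VV by (intro add_subgroup_msum_plus) (auto simp: X_def)
  moreover have "C \<subseteq> {sum_mset c + v | c v. set_mset c \<subseteq> X \<and> v \<in> S}"
  proof
    fix x assume "x \<in> C"
    then show "x \<in> {sum_mset c + v | c v. set_mset c \<subseteq> X \<and> v \<in> S}"
      using S(5) by (intro CollectI exI[of _ "{#}"] exI[of _ x]) auto
  qed
  ultimately have "{sum_mset c + v | c v. set_mset c \<subseteq> X \<and> v \<in> S} = UNIV"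
    using gen_subgroup_minimal C(2) by blast
  then have "\<exists>c s. set_mset c \<subseteq> X \<and> s \<in> S \<and> a = sum_mset c + s" for a by blast
  with F(1) S(4) show ?thesis by (intro that[of X S]) (auto simp: X_def)
qed

lemma add_subgroup_closure:
  fixes H :: "'a::topological_ab_group_add set"
  assumes "add_subgroup H"
  shows "add_subgroup (closure H)"
  unfolding add_subgroup_def
proof (intro conjI ballI)
  show "0 \<in> closure H" using add_subgroupD(1)[OF assms] closure_subset by blast
  \<comment> \<open>Addition is extended to the closure one variable at a time, using only
    continuity of translations.\<close>
  have *: "x + y \<in> closure H" if "x \<in> closure H" "y \<in> H" for x y
  proof -
    have "(\<lambda>x. x + y) ` closure H \<subseteq> closure H"
      using add_subgroupD(2)[OF assms] that closure_subset[of H]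
      by (intro image_closure_subset continuous_intros) auto
    then show ?thesis using that by blast
  qed
  show "x + y \<in> closure H" if "x \<in> closure H" "y \<in> closure H" for x y
  proof -
    have "(\<lambda>y. x + y) ` closure H \<subseteq> closure H"
      using * that by (intro image_closure_subset continuous_intros) auto
    then show ?thesis using that by blast
  qed
  show "- x \<in> closure H" if "x \<in> closure H" for x
  proof -
    have "uminus ` closure H \<subseteq> closure H"
      using add_subgroupD(3)[OF assms] closure_subset[of H]
      by (intro image_closure_subset continuous_intros) auto
    then show ?thesis using that by blast
  qed
qed

text \<open>The finitely many centres of a cover of \<open>C\<close> by translates of
  \<open>U\<close> can be taken in the union, hence in a single \<open>Ms n\<close>. The differences
  stay in the closure because it is a subgroup.\<close>

lemma compact_subset_sum_incseq:
  fixes Ms :: "nat \<Rightarrow> 'm::topological_ab_group_add set"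
  assumes "incseq Ms" "\<And>i. add_subgroup (Ms i)" "open U" "0 \<in> U" "U \<subseteq> V"
    and C: "compact C" "C \<subseteq> closure (\<Union>i. Ms i)"
  obtains n where "C \<subseteq> {m + v | m v. m \<in> Ms n \<and> v \<in> V \<inter> closure (\<Union>i. Ms i)}"
proof -
  obtain F where F: "finite F" "F \<subseteq> (\<Union>i. Ms i)" "\<And>x. x \<in> C \<Longrightarrow> \<exists>y\<in>F. x - y \<in> U"
    using compact_subset_finite_translates[OF C(1) assms(3,4) C(2)] by blast
  have "\<exists>n. F \<subseteq> Ms n"
    using F(1,2)
  proof (induction F)
    case (insert x F)
    then obtain m n where "F \<subseteq> Ms n" "x \<in> Ms m" by auto
    then have "insert x F \<subseteq> Ms (max m n)"
      using incseqD[OF assms(1), of m "max m n"] incseqD[OF assms(1), of n "max m n"] by auto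
    then show ?case by blast
  qed simp
  then obtain n where n: "F \<subseteq> Ms n" by blast
  have N: "add_subgroup (closure (\<Union>i. Ms i))"
    by (intro add_subgroup_closure add_subgroup_incseq_UN assms)
  show ?thesis
  proof (rule that[of n], intro subsetI CollectI)
    fix x assume x: "x \<in> C"
    obtain y where y: "y \<in> F" "x - y \<in> U" using F(3)[OF x] by blast
    have "x - y \<in> closure (\<Union>i. Ms i)"
      using x C(2) y(1) F(2) closure_subset[of "\<Union>i. Ms i"] by (intro add_subgroupD(4)[OF N]) auto
    then show "\<exists>m v. x = m + v \<and> m \<in> Ms n \<and> v \<in> V \<inter> closure (\<Union>i. Ms i)"
      using y n assms(5) by (intro exI[of _ y] exI[of _ "x - y"]) auto
  qed
qed

section \<open>The quotient topology\<close>

lemma coset_add_right: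
  assumes "add_subgroup H" "h \<in> H"
  shows "(+) (x + h) ` H = (+) x ` H"
proof (intro subset_antisym subsetI)
  show "z \<in> (+) x ` H" if "z \<in> (+) (x + h) ` H" for z
    using that add_subgroupD(2)[OF assms(1,2)] by (auto simp: add.assoc)
  fix z assume "z \<in> (+) x ` H"
  then obtain k where "k \<in> H" "z = x + k" by blast
  then have "z = x + h + (k - h)" "k - h \<in> H" using add_subgroupD(4)[OF assms(1)] assms(2) by auto
  then show "z \<in> (+) (x + h) ` H" by blast
qed

lemma coset_in_iff:
  assumes "add_subgroup H" "U \<subseteq> coset_space N H"
  shows "(+) x ` H \<in> U \<longleftrightarrow> x \<in> \<Union>U"
proof
  show "x \<in> \<Union>U" if "(+) x ` H \<in> U"
    using that add_subgroupD(1)[OF assms(1)] by (intro UnionI[OF that] image_eqI[of _ _ 0]) simp_all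
  assume "x \<in> \<Union>U"
  then obtain y h where "(+) y ` H \<in> U" "h \<in> H" "x = y + h"
    using assms(2) by (auto simp: coset_space_def)
  then show "(+) x ` H \<in> U" using coset_add_right[OF assms(1)] by simp
qed

text \<open>The defining predicate has to be shown to be a topology. For intersections this rests on
  \<open>coset_in_iff\<close>: a set of cosets is determined by its union, so unions of cosets
  commute with intersection.\<close>

lemma openin_quotient_top:
  assumes "add_subgroup H"
  shows "openin (quotient_top N H) U \<longleftrightarrow> U \<subseteq> coset_space N H \<and> openin (top_of_set N) (\<Union>U)"
proof -
  have "istopology (\<lambda>U. U \<subseteq> coset_space N H \<and> openin (top_of_set N) (\<Union>U))"
    unfolding istopology_def
  proof (intro conjI allI impI)
    fix A B
    assume A: "A \<subseteq> coset_space N H \<and> openin (top_of_set N) (\<Union>A)"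
      and B: "B \<subseteq> coset_space N H \<and> openin (top_of_set N) (\<Union>B)"
    show AB: "A \<inter> B \<subseteq> coset_space N H" using A by blast
    have "x \<in> \<Union>(A \<inter> B) \<longleftrightarrow> x \<in> \<Union>A \<inter> \<Union>B" for x
      unfolding coset_in_iff[OF assms AB, symmetric] Int_iff
        coset_in_iff[OF assms conjunct1[OF A]] coset_in_iff[OF assms conjunct1[OF B]] ..
    then have "\<Union>(A \<inter> B) = \<Union>A \<inter> \<Union>B" by (rule set_eqI)
    then show "openin (top_of_set N) (\<Union>(A \<inter> B))" using A B by auto
  next
    fix \<K> assume *: "\<forall>A\<in>\<K>. A \<subseteq> coset_space N H \<and> openin (top_of_set N) (\<Union>A)"
    then show "\<Union>\<K> \<subseteq> coset_space N H" by blast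
    have "\<Union>(\<Union>\<K>) = \<Union>(Union ` \<K>)" by blast
    moreover have "openin (top_of_set N) (\<Union>(Union ` \<K>))"
      using * by (intro openin_Union) blast
    ultimately show "openin (top_of_set N) (\<Union>(\<Union>\<K>))" by (simp only:)
  qed
  then show ?thesis by (simp add: quotient_top_def topology_inverse')
qed

text \<open>By \<open>cover\<close>, the compact set \<open>C\<close> meets every coset, so the
  quotient is the image of \<open>C\<close> under the continuous coset map.\<close>

lemma cocompact_inI:
  assumes H: "add_subgroup H" and N: "add_subgroup N" and HN: "H \<subseteq> N"
    and C: "compact C" "C \<subseteq> N" and cover: "\<And>x. x \<in> N \<Longrightarrow> \<exists>h\<in>H. x - h \<in> C"
  shows "cocompact_in H N"
proof -
  have Union: "\<Union>(coset_space N H) = N"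
  proof (intro subset_antisym subsetI)
    show "x \<in> N" if "x \<in> \<Union>(coset_space N H)" for x
      using that HN add_subgroupD(2)[OF N] by (auto simp: coset_space_def)
    show "x \<in> \<Union>(coset_space N H)" if "x \<in> N" for x
      using that coset_in_iff[OF H order_refl, of x N] by (simp add: coset_space_def)
  qed
  have top: "topspace (quotient_top N H) = coset_space N H"
  proof (rule subset_antisym)
    show "topspace (quotient_top N H) \<subseteq> coset_space N H"
      using openin_topspace[of "quotient_top N H"] by (simp only: openin_quotient_top[OF H])
    have "openin (quotient_top N H) (coset_space N H)"
      by (simp add: openin_quotient_top[OF H] Union)
    then show "coset_space N H \<subseteq> topspace (quotient_top N H)" by (rule openin_subset)
  qed
  have "continuous_map (top_of_set N) (quotient_top N H) (\<lambda>x. (+) x ` H)"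
    unfolding continuous_map
  proof (intro conjI allI impI)
    show "(\<lambda>x. (+) x ` H) ` topspace (top_of_set N) \<subseteq> topspace (quotient_top N H)"
      unfolding top by (auto simp: coset_space_def)
    fix U assume "openin (quotient_top N H) U"
    then have U: "U \<subseteq> coset_space N H" "openin (top_of_set N) (\<Union>U)"
      by (simp_all add: openin_quotient_top[OF H])
    have "{x \<in> topspace (top_of_set N). (+) x ` H \<in> U} = \<Union>U"
      using coset_in_iff[OF H U(1)] openin_subset[OF U(2)] by auto
    then show "openin (top_of_set N) {x \<in> topspace (top_of_set N). (+) x ` H \<in> U}"
      using U(2) by simp
  qed
  moreover have "compactin (top_of_set N) C" using C by (simp add: compactin_subtopology)
  ultimately have "compactin (quotient_top N H) ((\<lambda>x. (+) x ` H) ` C)" by (rule image_compactin[rotated])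
  moreover have "(\<lambda>x. (+) x ` H) ` C = coset_space N H"
  proof (intro subset_antisym subsetI)
    show "z \<in> coset_space N H" if "z \<in> (\<lambda>x. (+) x ` H) ` C" for z
      using that C(2) by (auto simp: coset_space_def)
    fix z assume "z \<in> coset_space N H"
    then obtain x where x: "x \<in> N" "z = (+) x ` H" by (auto simp: coset_space_def)
    obtain h where h: "h \<in> H" "x - h \<in> C" using cover[OF x(1)] by blast
    have "z = (+) (x - h) ` H" using coset_add_right[OF H h(1), of "x - h"] x(2) by simp
    then show "z \<in> (\<lambda>x. (+) x ` H) ` C" using h(2) by blast
  qed
  ultimately show ?thesis by (simp add: cocompact_in_def compact_space_def top)
qed

section \<open>Ascending chains of submodules\<close>

lemma incseq_eventually_const:
  fixes N :: "nat \<Rightarrow> 'm set"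
  assumes "finite {j. N (Suc j) \<noteq> N j}"
  obtains k where "\<And>j. j \<ge> k \<Longrightarrow> N j = N k"
proof -
  obtain k where k: "{j. N (Suc j) \<noteq> N j} \<subseteq> {..<k}"
    using assms finite_nat_iff_bounded by blast
  have *: "N (Suc j) = N j" if "j \<ge> k" for j using k that by fastforce
  have "N j = N k" if "j \<ge> k" for j
    using that by (induction j rule: dec_induct) (simp_all add: *)
  then show ?thesis by (rule that)
qed

text \<open>A jump either misses \<open>T 0\<close> or contains a sum of generators plus an error,
  since these sums form a subgroup containing \<open>T 0\<close>. Each kind occurs only finitely
  often.\<close>

lemma (in filtered_module) incseq_stabilises:
  assumes spanning: "(\<Union>n. T n) = UNIV"
    and symf: "\<And>x. x \<in> f ` {..<r} \<Longrightarrow> - x \<in> f ` {..<r}"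
    and zeroV: "0 \<in> V" and symV: "\<And>v. v \<in> V \<Longrightarrow> - v \<in> V"
    and VV: "\<And>u v. u \<in> V \<Longrightarrow> v \<in> V \<Longrightarrow> \<exists>x\<in>f ` {..<r}. u + v - x \<in> V"
    and sub: "\<And>j. add_subgroup (N j)" and mono: "incseq N"
    and inv: "\<And>j p. p \<in> P \<Longrightarrow> act (g p) ` N j \<subseteq> N j"
    and small: "\<And>j x v. x \<in> insert 0 (f ` {..<r}) \<Longrightarrow> v \<in> V \<Longrightarrow> x + v \<in> N j \<Longrightarrow> x + v \<in> N 0"
  obtains k where "\<And>j. j \<ge> k \<Longrightarrow> N j = N k"
proof -
  let ?G = "{sum_mset c + v | c v. set_mset c \<subseteq> f ` {..<r} \<and> v \<in> V}"
  have "T 0 \<subseteq> ?G"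
    unfolding T_def
  proof (intro gen_subgroup_minimal add_subgroup_msum_plus symf zeroV symV VV subsetI)
    fix x assume "x \<in> f ` {..<r} \<union> V \<union> e ` {..<0}"
    then consider "x \<in> f ` {..<r}" | "x \<in> V" by auto
    then show "x \<in> ?G"
    proof cases
      case 1
      then show ?thesis using zeroV by (intro CollectI exI[of _ "{#x#}"] exI[of _ 0]) auto
    next
      case 2
      then show ?thesis by (intro CollectI exI[of _ "{#}"] exI[of _ x]) auto
    qed
  qed
  then have "{j. N (Suc j) \<noteq> N j} \<subseteq> {j. N (Suc j) \<noteq> N j \<and> (N (Suc j) - N j) \<inter> T 0 = {}} \<union>
      {j. \<exists>c v. set_mset c \<subseteq> f ` {..<r} \<and> v \<in> V \<and> sum_mset c + v \<in> N (Suc j) - N j}"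
    by blast
  moreover have "finite {j. N (Suc j) \<noteq> N j \<and> (N (Suc j) - N j) \<inter> T 0 = {}}"
    using sub mono inv spanning by (rule finite_jumps_missing_T0)
  moreover have "finite {j. \<exists>c v. set_mset c \<subseteq> f ` {..<r} \<and> v \<in> V \<and> sum_mset c + v \<in> N (Suc j) - N j}"
    using _ symV VV sub mono small by (rule finite_jumps_meeting_msum_plus) simp
  ultimately have "finite {j. N (Suc j) \<noteq> N j}" by (meson finite_UnI finite_subset)
  then show ?thesis using that by (rule incseq_eventually_const)
qed

theorem mainTheorem13:
  fixes act :: "'a::{topological_ab_group_add, t2_space} \<Rightarrow> 'm::{topological_ab_group_add, t2_space} \<Rightarrow> 'm"
    and Ms :: "nat \<Rightarrow> 'm set"
  assumes "locally_compact_space (euclidean :: 'a topology)"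
    and "compactly_generated_group TYPE('a)"
    and "locally_compact_space (euclidean :: 'm topology)"
    and "LC_module_action act"
    and "compactly_generated_module act"
    and "\<And>i. submodule act (Ms i)"
    and "\<And>i. closed (Ms i)"
    and "\<And>i. Ms i \<subseteq> Ms (Suc i)"
  shows "\<exists>n0. \<forall>n\<ge>n0. cocompact_in (Ms n) (closure (\<Union>i. Ms i))"
proof -
  have act_zero: "act 0 x = x" and act_plus: "act (a + b) x = act a (act b x)"
    and act_add: "act a (x + y) = act a x + act a y" for a b x y
    using assms(4) by (simp_all add: LC_module_action_def)
  have act_cont: "continuous_on UNIV (\<lambda>(a, x). act a x)" "continuous_on UNIV (act a)" for a
    using assms(4) by (auto simp: LC_module_action_def dest: homeomorphism_cont1)
  have Ms: "add_subgroup (Ms i)" "act a ` Ms i \<subseteq> Ms i" for i a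
    using assms(6)[of i] by (auto simp: submodule_def)
  have Ms_mono: "incseq Ms" using assms(8) by (rule incseq_SucI)
  define N where "N = closure (\<Union>i. Ms i)"
  have N: "add_subgroup N"
    unfolding N_def by (intro add_subgroup_closure add_subgroup_incseq_UN Ms(1) Ms_mono)
  have Ms_N: "Ms i \<subseteq> N" for i unfolding N_def using closure_subset[of "\<Union>i. Ms i"] by blast
  have act_N: "act a ` N \<subseteq> N" for a
    unfolding N_def
  proof (rule image_closure_subset)
    show "continuous_on (closure (\<Union>i. Ms i)) (act a)" by (rule continuous_on_subset[OF act_cont(2)]) simp
    show "act a ` (\<Union>i. Ms i) \<subseteq> closure (\<Union>i. Ms i)" using Ms(2) closure_subset[of "\<Union>i. Ms i"] by blast
  qed simp

  \<comment> \<open>Compact generating data for the group and the module\<close>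
  obtain X S where X: "finite (X :: 'a set)" and S: "compact S"
    and XS: "\<And>a. \<exists>c s. set_mset c \<subseteq> X \<and> s \<in> S \<and> a = sum_mset c + s"
    using compactly_generated_group_decomposition[OF assms(1,2)] by blast
  obtain K where K: "compact K" "gen_submodule act K = UNIV"
    using assms(5) unfolding compactly_generated_module_def by blast
  \<comment> \<open>\<open>V\<close> is chosen to contain the translates of \<open>K\<close> by
    \<open>S\<close>, as \<open>spanning_T\<close> requires.\<close>
  have "compact ((\<lambda>(a, x). act a x) ` (S \<times> K))"
    by (intro compact_continuous_image compact_Times S K continuous_on_subset[OF act_cont(1)]) simp
  then obtain U V where U: "open U" "0 \<in> U" "U \<subseteq> V" and V: "compact V"
    and SKV: "(\<lambda>(a, x). act a x) ` (S \<times> K) \<subseteq> V" and symV: "\<And>v. v \<in> V \<Longrightarrow> - v \<in> V"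
    by (rule symmetric_compact_neighbourhood[OF assms(3)]) (rule that)
  have zeroV: "0 \<in> V" using U by blast

  \<comment> \<open>One finite set \<open>F\<close> is to absorb both sums of two errors and errors
    moved by the operators, which gives \<open>VV\<close> and \<open>gV\<close> at once.\<close>
  define C where "C = (\<lambda>(x, y). x + y) ` (V \<times> V) \<union> (\<Union>a\<in>X. act a ` V)"
  have "compact C"
    unfolding C_def
    by (intro compact_Un compact_sum_image compact_UN compact_continuous_image X V continuous_on_subset[OF act_cont(2)]) simp
  then obtain F0 where F0: "finite F0" "\<And>x. x \<in> C \<Longrightarrow> \<exists>y\<in>F0. x - y \<in> U"
    using compact_subset_finite_translates[OF _ U(1,2), of C UNIV] by auto
  define F where "F = insert 0 (F0 \<union> uminus ` F0)"
  have F: "finite F" "0 \<in> F" "\<And>x. x \<in> F \<Longrightarrow> - x \<in> F" using F0(1) by (auto simp: F_def)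
  have CF: "\<exists>y\<in>F. x - y \<in> V" if "x \<in> C" for x
    using F0(2)[OF that] U(3) unfolding F_def by blast
  obtain r and f :: "nat \<Rightarrow> 'm" where f: "F = f ` {..<r}"
    using finite_imp_nat_seg_image_inj_on[OF F(1)] by (auto simp: lessThan_def)
  have r: "r > 0" using f F(2) by (cases r) auto
  \<comment> \<open>As many primes as there are elements of \<open>X\<close>, to serve as their
    labels.\<close>
  obtain P where P: "finite P" "card P = card X" "P \<subseteq> {p::nat. prime p}"
    using infinite_arbitrarily_large[OF primes_infinite] by blast
  obtain g where "bij_betw g P X" using finite_same_card_bij[OF P(1) X P(2)] by blast
  then have g: "g ` P = X" by (rule bij_betw_imp_surj_on)
  interpret filtered_module act P g r f V
  proof
    show "\<exists>l<r. act (g p) v - f l \<in> V" if "p \<in> P" "v \<in> V" for p v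
      using CF[of "act (g p) v"] that g by (auto simp: C_def f)
  qed (use act_zero act_plus act_add P r in auto)
  have spanning: "(\<Union>n. T n) = UNIV"
  proof (rule spanning_T[OF _ _ K(2)])
    show "\<exists>c s. set_mset c \<subseteq> g ` P \<and> s \<in> S \<and> a = sum_mset c + s" for a using XS g by simp
    show "act s x \<in> V" if "s \<in> S" "x \<in> K" for s x using SKV that by auto
  qed

  \<comment> \<open>The chain of sets \<open>W n\<close> and its stabilisation\<close>
  define W where "W n = {m + v | m v. m \<in> Ms n \<and> v \<in> V \<inter> N}" for n
  have W_mono: "W m \<subseteq> W n" if "m \<le> n" for m n
    using incseqD[OF Ms_mono that] unfolding W_def by blast
  have W_N: "W n \<subseteq> N" for n
    using Ms_N add_subgroupD(2)[OF N] by (auto simp: W_def)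
  have absorb: "\<exists>n. B \<subseteq> W n" if "compact B" "B \<subseteq> N" for B
    by (rule compact_subset_sum_incseq[OF Ms_mono Ms(1) U that[unfolded N_def]])
       (auto simp: W_def N_def)
  have VN: "compact (V \<inter> N)" using V by (simp add: N_def compact_Int_closed)
  \<comment> \<open>The three parts make \<open>W n\<close> closed under addition, make it stable
    under the operators, and provide the hypothesis \<open>small\<close>. All are compact subsets of
    \<open>N\<close>, so one index \<open>n0\<close> absorbs them.\<close>
  define B where "B = (\<lambda>(x, y). x + y) ` ((V \<inter> N) \<times> (V \<inter> N)) \<union> (\<Union>a\<in>X. act a ` (V \<inter> N)) \<union>
    ((\<lambda>(x, y). x + y) ` (F \<times> V)) \<inter> N"
  have "compact B"
    unfolding B_def
    by (intro compact_Un compact_sum_image compact_UN compact_continuous_image compact_Int_closed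
        X V VN finite_imp_compact F continuous_on_subset[OF act_cont(2)]) (simp_all add: N_def)
  moreover have "B \<subseteq> N" using act_N add_subgroupD(2)[OF N] by (auto simp: B_def)
  ultimately obtain n0 where n0: "B \<subseteq> W n0" using absorb by blast
  have BW: "B \<subseteq> W n" if "n \<ge> n0" for n using n0 W_mono[OF that] by blast
  have W_plus: "m + x \<in> W n" if m: "m \<in> Ms n" and x: "x \<in> W n" for m x n
  proof -
    obtain l v where "l \<in> Ms n" "v \<in> V \<inter> N" "x = l + v" using x unfolding W_def by blast
    then show ?thesis using add_subgroupD(2)[OF Ms(1) m] unfolding W_def
      by (intro CollectI exI[of _ "m + l"] exI[of _ v]) (simp add: add.assoc)
  qed
  have W_subgroup: "add_subgroup (W n)" if n: "n \<ge> n0" for n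
    unfolding add_subgroup_def
  proof (intro conjI ballI)
    show "0 \<in> W n"
      using add_subgroupD(1)[OF Ms(1)[of n]] add_subgroupD(1)[OF N] zeroV unfolding W_def
      by (intro CollectI exI[of _ 0]) simp
    show "- x \<in> W n" if x: "x \<in> W n" for x
    proof -
      obtain m v where "m \<in> Ms n" "v \<in> V \<inter> N" "x = m + v" using x unfolding W_def by blast
      then show ?thesis using add_subgroupD(3)[OF Ms(1)] add_subgroupD(3)[OF N] symV unfolding W_def
        by (intro CollectI exI[of _ "- m"] exI[of _ "- v"]) auto
    qed
    fix x y assume "x \<in> W n" "y \<in> W n"
    then obtain l u m v where *: "l \<in> Ms n" "u \<in> V \<inter> N" "x = l + u" "m \<in> Ms n" "v \<in> V \<inter> N" "y = m + v"
      unfolding W_def by blast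
    then have "u + v \<in> B" unfolding B_def by (intro UnI1 image_eqI[of _ _ "(u, v)"]) simp_all
    then have "(l + m) + (u + v) \<in> W n"
      by (rule W_plus[OF add_subgroupD(2)[OF Ms(1) *(1,4)] subsetD[OF BW[OF n]]])
    then show "x + y \<in> W n" using * by (simp add: algebra_simps)
  qed
  have W_act: "act (g p) ` W n \<subseteq> W n" if n: "n \<ge> n0" and p: "p \<in> P" for n p
  proof
    fix y assume "y \<in> act (g p) ` W n"
    then obtain m v where *: "m \<in> Ms n" "v \<in> V \<inter> N" "y = act (g p) (m + v)" unfolding W_def by blast
    then have "act (g p) v \<in> B" using p g unfolding B_def by blast
    moreover have "act (g p) m \<in> Ms n" using *(1) Ms(2) by blast
    ultimately have "act (g p) m + act (g p) v \<in> W n" using W_plus BW[OF n] by blast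
    then show "y \<in> W n" by (simp add: * act_add)
  qed
  \<comment> \<open>The chain is shifted to start at \<open>n0\<close>, from where on its members
    are subgroups stable under the operators.\<close>
  obtain k where k: "\<And>j. j \<ge> k \<Longrightarrow> W (n0 + j) = W (n0 + k)"
  proof (rule incseq_stabilises[where N = "\<lambda>j. W (n0 + j)"])
    show "(\<Union>n. T n) = UNIV" by (rule spanning)
    show "- x \<in> f ` {..<r}" if "x \<in> f ` {..<r}" for x using that F(3) f by simp
    show "\<exists>x\<in>f ` {..<r}. u + v - x \<in> V" if "u \<in> V" "v \<in> V" for u v
      unfolding f[symmetric] using that by (intro CF) (auto simp: C_def)
    show "incseq (\<lambda>j. W (n0 + j))" by (simp add: incseq_def W_mono)
    show "x + v \<in> W (n0 + 0)"
      if "x \<in> insert 0 (f ` {..<r})" "v \<in> V" "x + v \<in> W (n0 + j)" for j x v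
    proof -
      have "x \<in> F" using that F(2) f by auto
      moreover have "x + v \<in> N" using that W_N by blast
      ultimately have "x + v \<in> B" unfolding B_def using that(2)
        by (intro UnI2 IntI image_eqI[of _ _ "(x, v)"]) simp_all
      then show ?thesis using n0 by auto
    qed
  qed (use zeroV symV W_subgroup W_act in auto)
  \<comment> \<open>Each point of \<open>N\<close> lies in some \<open>W m\<close> by
    \<open>absorb\<close>, and beyond \<open>n0 + k\<close> all these sets coincide.\<close>
  have W_eq: "W n = N" if n: "n \<ge> n0 + k" for n
  proof (rule subset_antisym[OF W_N subsetI])
    fix x assume "x \<in> N"
    then obtain m where m: "x \<in> W m" using absorb[of "{x}"] by auto
    define m' where "m' = max m n"
    have "W m' = W n" using k[of "m' - n0"] k[of "n - n0"] n by (simp add: m'_def)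
    then show "x \<in> W n" using m W_mono[of m m'] by (auto simp: m'_def)
  qed
  have "cocompact_in (Ms n) N" if n: "n \<ge> n0 + k" for n
  proof (rule cocompact_inI[OF Ms(1) N Ms_N VN])
    fix x assume "x \<in> N"
    then have "x \<in> W n" using W_eq[OF n] by simp
    then obtain m v where "m \<in> Ms n" "v \<in> V \<inter> N" "x = m + v" unfolding W_def by blast
    then show "\<exists>h\<in>Ms n. x - h \<in> V \<inter> N" by (intro bexI[of _ m]) simp_all
  qed simp
  then show ?thesis unfolding N_def by blast
qed

end
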